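(* Let $p$ be an odd prime, let $B_p$ be the set of $p\times p$ $(0,1)$-matrices, and let $B_p^*=\{A\in B_p:\det(A)\not\equiv0\pmod p\}$. Let $B_p^\dagger$ be a set of representatives in $B_p$ of the row permutation classes (two matrices are in the same class if one is obtained from the other by permuting rows). For $A\in B_p$ let $\sigma_0(A)$ be the number of zero entries of $A$. Then \[ \sum_{A\in B_p^\dagger\cap B_p^*}(-1)^{\sigma_0(A)}\,\mathrm{per}(A)\equiv-1\pmod p. \]
   Context: $\mathrm{per}$ denotes the permanent. *)

theory Defs
  imports "Jordan_Normal_Form.Determinant" "HOL-Number_Theory.Cong"
begin

definition per :: "'a :: comm_semiring_1 mat \<Rightarrow> 'a" where
  "per A = (if dim_row A = dim_col A
     then \<Sum>\<pi> | \<pi> permutes {0..<dim_row A}. \<Prod>i = 0..<dim_row A. A $$ (i, \<pi> i)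
     else 0)"

definition zero_one_mats :: "nat \<Rightarrow> int mat set" where
  "zero_one_mats n = {A \<in> carrier_mat n n. \<forall>i<n. \<forall>j<n. A $$ (i, j) \<in> {0, 1}}"

definition zero_one_mats_nonsing :: "nat \<Rightarrow> int mat set" where
  "zero_one_mats_nonsing n = {A \<in> zero_one_mats n. \<not> [det A = 0] (mod int n)}"

definition row_perm_equiv :: "'a mat \<Rightarrow> 'a mat \<Rightarrow> bool" where
  "row_perm_equiv A B \<longleftrightarrow>
     (\<exists>\<pi>. \<pi> permutes {0..<dim_row A} \<and>
          B = mat (dim_row A) (dim_col A) (\<lambda>(i, j). A $$ (\<pi> i, j)))"

definition row_perm_reps :: "nat \<Rightarrow> int mat set \<Rightarrow> bool" where
  "row_perm_reps n R \<longleftrightarrow>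
     R \<subseteq> zero_one_mats n \<and> (\<forall>A \<in> zero_one_mats n. \<exists>!B. B \<in> R \<and> row_perm_equiv A B)"

definition num_zeros :: "'a :: zero mat \<Rightarrow> nat" where
  "num_zeros A = card {(i, j). i < dim_row A \<and> j < dim_col A \<and> A $$ (i, j) = 0}"

end

theory Submission
  imports Defs "HOL-Number_Theory.Residues"
begin

text \<open>
  A matrix that is nonsingular modulo \<open>p\<close> has distinct rows, so expanding the permanent turns the
  sum over representatives into the sum of \<open>(-1)^\<sigma>\<^sub>0(B) \<Prod>\<^sub>i B\<^sub>i\<^sub>i\<close> over all nonsingular
  zero-one matrices \<open>B\<close>. By Fermat, nonsingularity may be replaced by the factor \<open>det(B)^(p-1)\<close>.
  Expanding this power, the alternating sum over \<open>B\<close> extracts the coefficient of the product of all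
  matrix entries, which is the signed number of tuples \<open>(\<pi>\<^sub>1, \<dots>, \<pi>\<^sub>p\<^sub>-\<^sub>1)\<close> of permutations that
  together with the identity form a Latin square. Conjugation by a \<open>p\<close>-cycle acts on these tuples
  and preserves signs. A fixed tuple consists of the nontrivial powers of the cycle, which are even,
  in some order. Hence the sum is \<open>(p-1)!\<close> modulo \<open>p\<close>, and Wilson's theorem finishes the proof.
\<close>

section \<open>Sums invariant under a map of prime order\<close>

text \<open>The periods \<open>p\<close> and \<open>d\<close> combine through an inverse
  \<open>m\<close> of \<open>d\<close> modulo \<open>p\<close>: iterating \<open>d * m\<close> times
  returns \<open>x\<close>, yet agrees with a single application of \<open>f\<close>.\<close>

lemma funpow_fixpoint_coprime:
  assumes "(f ^^ p) x = x" and "(f ^^ d) x = x" and "coprime d p" and "1 < p"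
  shows "f x = x"
proof -
  obtain m where m: "[d * m = Suc 0] (mod p)"
    using cong_solve_coprime_nat[OF assms(3)] by blast
  have "((f ^^ d) ^^ m) x = x"
    using assms(2) by (induction m) auto
  then have "(f ^^ (d * m)) x = x"
    by (simp add: funpow_mult mult.commute)
  moreover have "(f ^^ (d * m)) x = (f ^^ ((d * m) mod p)) x"
    using funpow_mod_eq[OF assms(1)] by metis
  moreover have "(d * m) mod p = 1"
    using m assms(4) by (simp add: cong_def)
  ultimately show ?thesis by simp
qed

text \<open>A point that is not fixed has an orbit of exactly \<open>p\<close> elements, as
  \<open>p\<close> is prime; \<open>f\<close> is constant on it, so the orbit contributes a multiple
  of \<open>p\<close>. The induction removes one such orbit at a time.\<close>

lemma sum_cong_sum_fixpoints:
  fixes f :: "'a \<Rightarrow> int" and p :: nat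
  assumes p: "prime p" and "finite S"
    and "\<And>x. x \<in> S \<Longrightarrow> \<phi> x \<in> S"
    and "\<And>x. x \<in> S \<Longrightarrow> (\<phi> ^^ p) x = x"
    and "\<And>x. x \<in> S \<Longrightarrow> f (\<phi> x) = f x"
  shows "[sum f S = sum f {x \<in> S. \<phi> x = x}] (mod int p)"
  using assms(2-)
proof (induction S rule: finite_psubset_induct)
  case (psubset S)
  note closed = psubset.prems(1) and period = psubset.prems(2) and inv = psubset.prems(3)
  show ?case
  proof (cases "\<forall>x\<in>S. \<phi> x = x")
    case True
    then have "{x \<in> S. \<phi> x = x} = S" by auto
    then show ?thesis by simp
  next
    case False
    then obtain x where x: "x \<in> S" "\<phi> x \<noteq> x" by auto
    have p1: "1 < p" using p prime_gt_1_nat by blast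
    define orb where "orb = (\<lambda>k. (\<phi> ^^ k) x) ` {0..<p}"
    have iter: "(\<phi> ^^ k) x \<in> S" for k
      using x closed by (induction k) auto
    \<comment> \<open>A fixed point on the orbit stays put for the remaining \<open>p - k\<close>
      steps, which lead back to \<open>x\<close>; then \<open>x\<close> itself would be
      fixed.\<close>
    have fix_iter: "\<phi> ((\<phi> ^^ k) x) \<noteq> (\<phi> ^^ k) x" if "k \<le> p" for k
    proof
      assume fp: "\<phi> ((\<phi> ^^ k) x) = (\<phi> ^^ k) x"
      have *: "(\<phi> ^^ m) ((\<phi> ^^ k) x) = (\<phi> ^^ k) x" for m
        using fp by (induction m) auto
      have "(\<phi> ^^ (p - k)) ((\<phi> ^^ k) x) = (\<phi> ^^ p) x"
        using that by (metis comp_apply funpow_add le_add_diff_inverse2)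
      then have "(\<phi> ^^ k) x = x" using * period x by simp
      then show False using fp x by simp
    qed
    \<comment> \<open>A coincidence would give the iterate a period \<open>j - i\<close> strictly
      between 0 and \<open>p\<close>, hence coprime to \<open>p\<close>, and so make it a fixed
      point.\<close>
    have neq: "(\<phi> ^^ i) x \<noteq> (\<phi> ^^ j) x" if "i < j" "j < p" for i j
    proof
      assume eq: "(\<phi> ^^ i) x = (\<phi> ^^ j) x"
      have "(\<phi> ^^ (j - i)) ((\<phi> ^^ i) x) = (\<phi> ^^ i) x"
        using eq that by (metis comp_apply funpow_add le_add_diff_inverse2 less_imp_le)
      moreover have "coprime (j - i) p"
        using that p by (metis coprime_commute prime_imp_coprime_nat diff_less_mono2
            dvd_imp_le not_le less_imp_diff_less zero_less_diff)
      ultimately have "\<phi> ((\<phi> ^^ i) x) = (\<phi> ^^ i) x"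
        using funpow_fixpoint_coprime period[OF iter] p1 by metis
      then show False using fix_iter[of i] that by simp
    qed
    have inj: "inj_on (\<lambda>k. (\<phi> ^^ k) x) {0..<p}"
      by (rule inj_onI) (metis neq atLeastLessThan_iff linorder_neqE_nat)
    have orbS: "orb \<subseteq> S" using iter by (auto simp: orb_def)
    have "x \<in> orb" unfolding orb_def using p1 by (intro image_eqI[of _ _ 0]) auto
    have f_iter: "f ((\<phi> ^^ k) x) = f x" for k
      by (induction k) (auto simp: inv iter)
    have sum_orb: "sum f orb = int p * f x"
      unfolding orb_def by (simp add: sum.reindex[OF inj] f_iter)
    have orb_closed: "\<phi> z \<in> orb" if z: "z \<in> orb" for z
    proof -
      obtain k where k: "k < p" "z = (\<phi> ^^ k) x"
        using z unfolding orb_def by auto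
      have "\<phi> z = (\<phi> ^^ (Suc k mod p)) x"
        using k funpow_mod_eq[OF period[OF x(1)], of "Suc k"] by simp
      then show ?thesis using p1 by (auto simp: orb_def)
    qed
    \<comment> \<open>On \<open>S\<close> the iterate \<open>\<phi> ^^ (p - 1)\<close> undoes
      \<open>\<phi>\<close>, so no point outside the orbit is mapped into it.\<close>
    have "\<phi> z \<in> S - orb" if z: "z \<in> S - orb" for z
    proof -
      have "z \<in> orb" if "\<phi> z \<in> orb"
      proof -
        have "(\<phi> ^^ m) (\<phi> z) \<in> orb" for m
          using that orb_closed by (induction m) auto
        moreover have "(\<phi> ^^ Suc (p - 1)) z = z"
          using period[of z] z p1 by simp
        then have "(\<phi> ^^ (p - 1)) (\<phi> z) = z"
          by (simp only: funpow_Suc_right comp_apply)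
        ultimately show ?thesis by metis
      qed
      then show ?thesis using z closed by auto
    qed
    then have IH: "[sum f (S - orb) = sum f {x \<in> S - orb. \<phi> x = x}] (mod int p)"
      using psubset.IH[of "S - orb"] \<open>x \<in> orb\<close> x period inv by blast
    have "{x \<in> S - orb. \<phi> x = x} = {x \<in> S. \<phi> x = x}"
      using fix_iter by (force simp: orb_def)
    moreover have "sum f S = sum f (S - orb) + int p * f x"
      using sum.subset_diff[OF orbS \<open>finite S\<close>] sum_orb by metis
    ultimately show ?thesis using IH by (simp add: cong_def)
  qed
qed

section \<open>Cyclic shifts\<close>

text \<open>The \<open>a\<close>-th power of an \<open>n\<close>-cycle, extended by the identity so
  that it \<open>permutes {0..<n}\<close>.\<close>

definition shift :: "nat \<Rightarrow> nat \<Rightarrow> nat \<Rightarrow> nat" where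
  "shift n a i = (if i < n then (i + a) mod n else i)"

lemma shift_0 [simp]: "shift n 0 = id"
  by (auto simp: shift_def)

lemma shift_comp: "shift n a \<circ> shift n b = shift n (a + b)"
  by (auto simp: shift_def fun_eq_iff mod_simps ac_simps)

lemma shift_mult_self [simp]: "shift n (n * a) = id"
  by (auto simp: shift_def)

lemma shift_self [simp]: "shift n n = id"
  by (auto simp: shift_def)

lemma shift_permutes: "shift n a permutes {0..<n}"
proof (rule bij_imp_permutes)
  \<comment> \<open>The natural number \<open>a * (n - 1)\<close> stands for \<open>- a\<close>
    modulo \<open>n\<close>.\<close>
  have inv: "shift n a \<circ> shift n (a * (n - 1)) = id" "shift n (a * (n - 1)) \<circ> shift n a = id" if "0 < n"
  proof -
    have "a + a * (n - 1) = n * a" using that by (cases n) auto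
    then show "shift n a \<circ> shift n (a * (n - 1)) = id" "shift n (a * (n - 1)) \<circ> shift n a = id"
      by (simp_all add: shift_comp add.commute)
  qed
  show "bij_betw (shift n a) {0..<n} {0..<n}"
    by (rule bij_betw_byWitness[where f' = "shift n (a * (n - 1))"])
      (use inv in \<open>auto simp: shift_def fun_eq_iff split: if_splits\<close>)
qed (simp add: shift_def)

lemma permutation_shift: "permutation (shift n a)"
  using shift_permutes permutation_permutes by blast

lemma sign_shift_add: "sign (shift n (a + b)) = sign (shift n a) * sign (shift n b)"
  by (simp flip: shift_comp add: sign_compose permutation_shift)

lemma sign_shift_mult: "sign (shift n (k * a)) = sign (shift n a) ^ k"
  by (induction k) (simp_all add: sign_shift_add)

text \<open>The \<open>n\<close>-th power of a shift is the identity, and for odd \<open>n\<close>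
  the sign -1 has \<open>n\<close>-th power -1.\<close>

lemma sign_shift_odd:
  assumes "odd n"
  shows "sign (shift n a) = 1"
proof -
  have "sign (shift n a) ^ n = 1"
    using sign_shift_mult[of n n a] by simp
  then show ?thesis using assms by (auto simp: sign_def split: if_splits)
qed

section \<open>Signed enumeration of Latin squares\<close>

text \<open>A tuple in \<open>normalized_latin n\<close> together with the identity covers every cell of the
  \<open>n \<times> n\<close> board, hence by counting covers it exactly once: these are the Latin squares of order
  \<open>n\<close> whose row of index \<open>0\<close> is the identity.\<close>

definition normalized_latin :: "nat \<Rightarrow> (nat \<Rightarrow> nat \<Rightarrow> nat) set" where
  "normalized_latin n = {g \<in> {1..<n} \<rightarrow>\<^sub>E {\<pi>. \<pi> permutes {0..<n}}.
     \<forall>i<n. \<forall>j<n. i \<noteq> j \<longrightarrow> (\<exists>k\<in>{1..<n}. g k i = j)}"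

text \<open>Simultaneous conjugation of all entries by \<open>shift n a\<close>, whose inverse is
  \<open>shift n (a * (n - 1))\<close>. The parameter \<open>a\<close> gives the iterates a closed
  form.\<close>

definition shift_conj :: "nat \<Rightarrow> nat \<Rightarrow> (nat \<Rightarrow> nat \<Rightarrow> nat) \<Rightarrow> nat \<Rightarrow> nat \<Rightarrow> nat" where
  "shift_conj n a g = (\<lambda>k\<in>{1..<n}. shift n a \<circ> g k \<circ> shift n (a * (n - 1)))"

lemma finite_normalized_latin: "finite (normalized_latin n)"
  unfolding normalized_latin_def
  by (rule finite_subset[of _ "{1..<n} \<rightarrow>\<^sub>E {\<pi>. \<pi> permutes {0..<n}}"])
    (auto intro!: finite_PiE finite_permutations)

text \<open>Extensionality matters at \<open>a = 0\<close>, since \<open>shift_conj n 0\<close>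
  resets the values outside \<open>{1..<n}\<close>. At \<open>a = n\<close> the closed form yields
  the period \<open>n\<close> of conjugation.\<close>

lemma shift_conj_funpow:
  assumes "g \<in> extensional {1..<n}"
  shows "(shift_conj n 1 ^^ a) g = shift_conj n a g"
proof (induction a)
  case 0
  show ?case using assms by (auto simp: shift_conj_def fun_eq_iff extensional_def)
next
  case (Suc a)
  have "shift n 1 \<circ> (shift n a \<circ> g k \<circ> shift n (a * (n - 1))) \<circ> shift n (1 * (n - 1))
      = shift n (Suc a) \<circ> g k \<circ> shift n (Suc a * (n - 1))" for k
  proof -
    have "shift n 1 \<circ> (shift n a \<circ> g k \<circ> shift n (a * (n - 1))) \<circ> shift n (1 * (n - 1))
      = (shift n 1 \<circ> shift n a) \<circ> g k \<circ> (shift n (a * (n - 1)) \<circ> shift n (1 * (n - 1)))"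
      by (simp only: comp_assoc)
    then show ?thesis unfolding shift_comp by (simp add: add.commute)
  qed
  then show ?case unfolding funpow.simps comp_apply Suc
    by (auto simp: shift_conj_def fun_eq_iff)
qed

text \<open>The conjugate of \<open>g k\<close> covers a cell exactly when \<open>g k\<close> covers
  the cell one step back along the cycle in both coordinates, and this move keeps off-diagonal cells
  off the diagonal.\<close>

lemma shift_conj_normalized_latin:
  assumes g: "g \<in> normalized_latin n"
  shows "shift_conj n 1 g \<in> normalized_latin n"
proof -
  have "\<exists>k\<in>{1..<n}. shift_conj n 1 g k i = j" if ij: "i < n" "j < n" "i \<noteq> j" for i j
  proof -
    define i' where "i' = shift n (n - 1) i"
    define j' where "j' = shift n (n - 1) j"
    have undo: "shift n 1 (shift n (n - 1) x) = x" for x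
      using ij fun_cong[OF shift_comp[of n 1 "n - 1"], of x] by simp
    have "i' < n" "j' < n" using ij by (auto simp: i'_def j'_def shift_def)
    moreover have "i' \<noteq> j'" using undo ij by (metis i'_def j'_def)
    ultimately obtain k where "k \<in> {1..<n}" "g k i' = j'"
      using g unfolding normalized_latin_def by blast
    then show ?thesis using undo by (intro bexI[of _ k]) (auto simp: shift_conj_def i'_def j'_def)
  qed
  moreover have "shift_conj n 1 g \<in> {1..<n} \<rightarrow>\<^sub>E {\<pi>. \<pi> permutes {0..<n}}"
    using g unfolding shift_conj_def normalized_latin_def
    by (auto intro!: permutes_compose shift_permutes simp: PiE_iff)
  ultimately show ?thesis by (auto simp: normalized_latin_def)
qed

lemma sign_shift_conj:
  assumes "g \<in> normalized_latin n"
  shows "(\<Prod>k\<in>{1..<n}. sign (shift_conj n 1 g k)) = (\<Prod>k\<in>{1..<n}. sign (g k))"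
proof (rule prod.cong[OF refl])
  fix k assume k: "k \<in> {1..<n}"
  have perm: "permutation (g k)"
    using assms k unfolding normalized_latin_def permutation_permutes by blast
  have "sign (shift_conj n 1 g k) = sign (shift n 1) * sign (g k) * sign (shift n (n - 1))"
    using k by (simp add: shift_conj_def sign_compose permutation_shift perm permutation_compose)
  also have "\<dots> = sign (shift n (1 + (n - 1))) * sign (g k)"
    by (simp only: sign_shift_add ac_simps)
  also have "\<dots> = sign (g k)" using k by simp
  finally show "sign (shift_conj n 1 g k) = sign (g k)" .
qed

text \<open>The cycle is transitive on \<open>{0..<n}\<close>, so a permutation commuting with it is
  determined by its value at 0; the induction walks along the cycle from there.\<close>

lemma commute_shift_imp_shift:
  assumes "\<pi> permutes {0..<n}" and "0 < n" and comm: "\<pi> \<circ> shift n 1 = shift n 1 \<circ> \<pi>"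
  shows "\<pi> = shift n (\<pi> 0)"
proof
  fix i
  have "\<pi> i = shift n (\<pi> 0) i" if "i < n"
    using that
  proof (induction i)
    case 0
    then show ?case using assms permutes_in_image[OF assms(1), of 0] by (simp add: shift_def)
  next
    case (Suc i)
    have "\<pi> (Suc i) = \<pi> (shift n 1 i)" using Suc by (simp add: shift_def)
    also have "\<dots> = shift n 1 (\<pi> i)" using fun_cong[OF comm, of i] by simp
    also have "\<dots> = shift n (\<pi> 0) (Suc i)"
      using Suc by (simp add: shift_def mod_simps)
    finally show ?case .
  qed
  then show "\<pi> i = shift n (\<pi> 0) i"
    using permutes_not_in[OF assms(1), of i] by (cases "i < n") (auto simp: shift_def)
qed

text \<open>Each entry of a fixed tuple commutes with the cycle and is therefore a shift; the
  covering condition forces the shift amounts to exhaust \<open>{1..<n}\<close>.\<close>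

lemma fixpoints_shift_conj:
  assumes n: "0 < n"
  shows "{g \<in> normalized_latin n. shift_conj n 1 g = g}
    = (\<lambda>\<sigma>. \<lambda>k\<in>{1..<n}. shift n (\<sigma> k)) ` {\<sigma>. \<sigma> permutes {1..<n}}"
    (is "?L = ?F ` ?P")
proof (intro equalityI subsetI)
  fix g assume "g \<in> ?L"
  then have g: "g \<in> normalized_latin n" and fp: "shift_conj n 1 g = g" by auto
  have perm: "g k permutes {0..<n}" if "k \<in> {1..<n}" for k
    using g that by (auto simp: normalized_latin_def)
  have gk: "g k = shift n (g k 0)" if k: "k \<in> {1..<n}" for k
  proof (rule commute_shift_imp_shift[OF perm[OF k] n])
    have "g k = shift n 1 \<circ> g k \<circ> shift n (n - 1)"
      using fun_cong[OF fp, of k] k by (simp add: shift_conj_def)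
    then have "g k \<circ> shift n 1 = shift n 1 \<circ> g k \<circ> (shift n (n - 1) \<circ> shift n 1)"
      by (metis comp_assoc)
    then show "g k \<circ> shift n 1 = shift n 1 \<circ> g k"
      using n by (simp add: shift_comp)
  qed
  define \<sigma> where "\<sigma> k = (if k \<in> {1..<n} then g k 0 else k)" for k
  \<comment> \<open>Covering the cells \<open>(0, j)\<close> with \<open>j\<close> nonzero makes
    \<open>\<sigma>\<close> surjective; finiteness then makes it bijective.\<close>
  have sub: "{1..<n} \<subseteq> \<sigma> ` {1..<n}"
  proof
    fix j assume "j \<in> {1..<n}"
    then have "j < n" "0 \<noteq> j" by auto
    then obtain k where "k \<in> {1..<n}" "g k 0 = j"
      using g n unfolding normalized_latin_def by blast
    then show "j \<in> \<sigma> ` {1..<n}" by (auto simp: \<sigma>_def)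
  qed
  have im: "\<sigma> ` {1..<n} = {1..<n}"
    using card_seteq[OF _ sub] card_image_le[of "{1..<n}" \<sigma>] by auto
  then have "bij_betw \<sigma> {1..<n} {1..<n}"
    by (simp add: bij_betw_def eq_card_imp_inj_on)
  then have "\<sigma> permutes {1..<n}"
    by (rule bij_imp_permutes) (auto simp: \<sigma>_def)
  moreover have "g = ?F \<sigma>"
  proof
    fix k
    show "g k = ?F \<sigma> k"
    proof (cases "k \<in> {1..<n}")
      case True
      then show ?thesis using gk by (simp add: \<sigma>_def)
    next
      case False
      then show ?thesis using g by (auto simp: normalized_latin_def PiE_def extensional_def)
    qed
  qed
  ultimately show "g \<in> ?F ` ?P" by blast
next
  fix g assume "g \<in> ?F ` ?P"
  then obtain \<sigma> where \<sigma>: "\<sigma> permutes {1..<n}" and g: "g = ?F \<sigma>" by auto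
  have "\<exists>k\<in>{1..<n}. g k i = j" if ij: "i < n" "j < n" "i \<noteq> j" for i j
  proof -
    \<comment> \<open>\<open>d\<close> is \<open>j - i\<close> modulo \<open>n\<close>, with
      \<open>n\<close> added first where natural subtraction would truncate; it is nonzero because
      \<open>i \<noteq> j\<close>.\<close>
    define d where "d = (if i \<le> j then j - i else n + j - i)"
    have "d \<in> {1..<n}" and d: "(i + d) mod n = j"
      using ij by (auto simp: d_def)
    then obtain k where "k \<in> {1..<n}" "\<sigma> k = d"
      using permutes_image[OF \<sigma>] by (metis imageE)
    then show ?thesis using d ij by (intro bexI[of _ k]) (auto simp: g shift_def)
  qed
  then have "g \<in> normalized_latin n"
    by (auto simp: normalized_latin_def g shift_permutes)
  moreover have "shift_conj n 1 g = g"
  proof -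
    have "shift n 1 \<circ> shift n a \<circ> shift n (n - 1) = shift n a" for a
    proof -
      have "shift n 1 \<circ> shift n a \<circ> shift n (n - 1) = shift n (n + a)"
        using n by (simp add: shift_comp add.commute)
      then show ?thesis by (simp flip: shift_comp)
    qed
    then show ?thesis by (auto simp: shift_conj_def g fun_eq_iff)
  qed
  ultimately show "g \<in> ?L" by simp
qed

lemma inj_on_shift_tuple:
  "inj_on (\<lambda>\<sigma>. \<lambda>k\<in>{1..<n}. shift n (\<sigma> k)) {\<sigma>. \<sigma> permutes {1..<n}}"
proof (rule inj_onI, rule ext)
  fix \<sigma> \<tau> k
  assume \<sigma>: "\<sigma> \<in> {\<sigma>. \<sigma> permutes {1..<n}}" and \<tau>: "\<tau> \<in> {\<sigma>. \<sigma> permutes {1..<n}}"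
    and eq: "(\<lambda>k\<in>{1..<n}. shift n (\<sigma> k)) = (\<lambda>k\<in>{1..<n}. shift n (\<tau> k))"
  show "\<sigma> k = \<tau> k"
  proof (cases "k \<in> {1..<n}")
    case True
    then have "\<sigma> k < n" "\<tau> k < n" "0 < n"
      using \<sigma> \<tau> permutes_in_image by fastforce+
    moreover have "shift n (\<sigma> k) 0 = shift n (\<tau> k) 0"
      using fun_cong[OF eq, of k] True by simp
    ultimately show ?thesis by (simp add: shift_def)
  next
    case False
    then show ?thesis using \<sigma> \<tau> by (auto simp: permutes_not_in)
  qed
qed

text \<open>Modulo \<open>p\<close> only the tuples fixed under conjugation count; there are
  \<open>fact (p - 1)\<close> of them, each of sign 1 because \<open>p\<close> is odd.\<close>

lemma sum_sign_normalized_latin: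
  assumes "prime p" and "odd p"
  shows "[(\<Sum>g\<in>normalized_latin p. \<Prod>k\<in>{1..<p}. sign (g k)) = - 1] (mod int p)"
proof -
  let ?f = "\<lambda>g :: nat \<Rightarrow> nat \<Rightarrow> nat. \<Prod>k\<in>{1..<p}. sign (g k)"
  have p0: "0 < p" using assms prime_gt_0_nat by blast
  have period: "(shift_conj p 1 ^^ p) g = g" if "g \<in> normalized_latin p" for g
  proof -
    have g: "g \<in> extensional {1..<p}"
      using that by (auto simp: normalized_latin_def PiE_def)
    then show ?thesis
      by (subst shift_conj_funpow) (auto simp: shift_conj_def fun_eq_iff extensional_def)
  qed
  have "[sum ?f (normalized_latin p)
      = sum ?f {g \<in> normalized_latin p. shift_conj p 1 g = g}] (mod int p)"
    by (rule sum_cong_sum_fixpoints[OF assms(1) finite_normalized_latin])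
      (simp_all only: shift_conj_normalized_latin period sign_shift_conj)
  also have "sum ?f {g \<in> normalized_latin p. shift_conj p 1 g = g} = fact (p - 1)"
    unfolding fixpoints_shift_conj[OF p0] sum.reindex[OF inj_on_shift_tuple]
    by (simp add: sign_shift_odd[OF assms(2)] card_permutations)
  also have "[fact (p - 1) = - 1] (mod int p)"
    using wilson_theorem[OF assms(1)] by simp
  finally show ?thesis .
qed

section \<open>Reduction to Latin squares\<close>

text \<open>Passing to entry functions lets a sum over all matrices factor cell by cell.\<close>

lemma zero_one_mats_eq_image:
  "zero_one_mats n = mat n n ` (({0..<n} \<times> {0..<n}) \<rightarrow>\<^sub>E {0, 1})"
proof (intro equalityI subsetI)
  fix A assume A: "A \<in> zero_one_mats n"
  let ?a = "restrict (\<lambda>x. A $$ x) ({0..<n} \<times> {0..<n})"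
  have "A = mat n n ?a"
    using A by (intro eq_matI) (auto simp: zero_one_mats_def)
  moreover have "?a \<in> ({0..<n} \<times> {0..<n}) \<rightarrow>\<^sub>E {0, 1}"
  proof (rule PiE_I)
    fix x assume x: "x \<in> {0..<n} \<times> {0..<n}"
    then obtain i j where "x = (i, j)" "i < n" "j < n" by auto
    then have "A $$ x \<in> {0, 1}" using A unfolding zero_one_mats_def by blast
    then show "?a x \<in> {0, 1}" using x by simp
  qed (simp only: restrict_apply if_False)
  ultimately show "A \<in> mat n n ` (({0..<n} \<times> {0..<n}) \<rightarrow>\<^sub>E {0, 1})"
    by (rule image_eqI)
qed (auto simp: zero_one_mats_def PiE_iff)

lemma finite_zero_one_mats: "finite (zero_one_mats n)"
  unfolding zero_one_mats_eq_image by (intro finite_imageI finite_PiE) auto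

lemma sum_zero_one_mats:
  fixes f :: "int mat \<Rightarrow> 'b :: comm_monoid_add"
  shows "sum f (zero_one_mats n)
    = (\<Sum>b\<in>({0..<n} \<times> {0..<n}) \<rightarrow>\<^sub>E {0, 1}. f (mat n n b))"
proof -
  let ?D = "({0..<n} \<times> {0..<n}) \<rightarrow>\<^sub>E {0, 1 :: int}"
  have "inj_on (mat n n) ?D"
  proof (rule inj_onI)
    fix a b assume ab: "a \<in> ?D" "b \<in> ?D" and eq: "mat n n a = mat n n b"
    show "a = b"
    proof (rule PiE_ext[OF ab])
      fix x assume "x \<in> {0..<n} \<times> {0..<n}"
      then obtain i j where "x = (i, j)" "i < n" "j < n" by auto
      then show "a x = b x" using arg_cong[OF eq, of "\<lambda>M. M $$ (i, j)"] by simp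
    qed
  qed
  then show ?thesis by (simp add: zero_one_mats_eq_image sum.reindex)
qed

lemma power_num_zeros:
  fixes A :: "int mat"
  assumes "A \<in> carrier_mat n n"
  shows "(- 1) ^ num_zeros A
    = (\<Prod>i\<in>{0..<n}. \<Prod>j\<in>{0..<n}. if A $$ (i, j) = 0 then - 1 else 1 :: int)"
proof -
  let ?I = "{0..<n} \<times> {0..<n}"
  have eq: "{(i, j). i < dim_row A \<and> j < dim_col A \<and> A $$ (i, j) = 0}
      = {x \<in> ?I. A $$ x = 0}"
    using assms by auto
  have "(\<Prod>x\<in>?I. if A $$ x = 0 then - 1 else 1 :: int)
      = (\<Prod>x\<in>{x \<in> ?I. A $$ x = 0}. - 1)"
    by (rule prod.inter_filter[symmetric]) simp
  then show ?thesis
    unfolding num_zeros_def eq by (simp add: prod.cartesian_product case_prod_unfold)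
qed

text \<open>In row \<open>i\<close> only the column \<open>h i\<close> carries a factor other than
  1. Products along different permutations thus become products over the same set of cells and can
  be merged.\<close>

lemma prod_cover:
  fixes b :: "nat \<times> nat \<Rightarrow> int"
  assumes "h ` {0..<n} \<subseteq> {0..<n}"
  shows "(\<Prod>i\<in>{0..<n}. b (i, h i)) = (\<Prod>x\<in>{0..<n} \<times> {0..<n}. if h (fst x) = snd x then b x else 1)"
proof -
  have "(\<Prod>x\<in>{0..<n} \<times> {0..<n}. if h (fst x) = snd x then b x else 1)
      = (\<Prod>i\<in>{0..<n}. \<Prod>j\<in>{0..<n}. if h i = j then b (i, j) else 1)"
    by (simp only: prod.cartesian_product case_prod_unfold prod.collapse)
  also have "\<dots> = (\<Prod>i\<in>{0..<n}. b (i, h i))"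
    using assms by (intro prod.cong refl) (simp add: prod.delta' image_subset_iff)
  finally show ?thesis by simp
qed

text \<open>Summing a monomial over the values \<open>0\<close> (with sign \<open>-1\<close>) and \<open>1\<close> of a variable gives zero
  unless the variable occurs in it.\<close>

lemma sum_monomial_zero_one_mats:
  assumes g: "g \<in> {1..<n} \<rightarrow>\<^sub>E {\<pi>. \<pi> permutes {0..<n}}"
  shows "(\<Sum>B\<in>zero_one_mats n. (- 1) ^ num_zeros B * (\<Prod>i = 0..<n. B $$ (i, i))
      * (\<Prod>k\<in>{1..<n}. \<Prod>i = 0..<n. B $$ (i, g k i)))
    = (if g \<in> normalized_latin n then 1 else 0)"
proof -
  let ?I = "{0..<n} \<times> {0..<n}"
  \<comment> \<open>\<open>?c x b\<close> collects all that cell \<open>x\<close> with entry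
    \<open>b\<close> contributes: its sign, its diagonal factor, and a factor for every
    \<open>g k\<close> through the cell.\<close>
  let ?c = "\<lambda>x b. (if b = 0 then - 1 else 1) * (if fst x = snd x then b else 1)
      * (\<Prod>k\<in>{1..<n}. if g k (fst x) = snd x then b else 1 :: int)"
  have gk: "g k ` {0..<n} = {0..<n}" if "k \<in> {1..<n}" for k
    using g that permutes_image by blast
  have gk_less: "g k i < n" if "k \<in> {1..<n}" "i < n" for k i
    using gk that by fastforce
  have "(- 1) ^ num_zeros (mat n n b) * (\<Prod>i = 0..<n. mat n n b $$ (i, i))
      * (\<Prod>k\<in>{1..<n}. \<Prod>i = 0..<n. mat n n b $$ (i, g k i)) = (\<Prod>x\<in>?I. ?c x (b x))"
    for b :: "nat \<times> nat \<Rightarrow> int"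
  proof -
    have "(- 1) ^ num_zeros (mat n n b) = (\<Prod>x\<in>?I. if b x = 0 then - 1 else 1 :: int)"
      by (simp add: power_num_zeros[of _ n] prod.cartesian_product case_prod_unfold)
    moreover have "(\<Prod>i = 0..<n. mat n n b $$ (i, i)) = (\<Prod>x\<in>?I. if fst x = snd x then b x else 1)"
      using prod_cover[of "\<lambda>i. i" n b] by simp
    moreover have "(\<Prod>k\<in>{1..<n}. \<Prod>i = 0..<n. mat n n b $$ (i, g k i))
        = (\<Prod>x\<in>?I. \<Prod>k\<in>{1..<n}. if g k (fst x) = snd x then b x else 1)"
    proof -
      have "(\<Prod>i = 0..<n. mat n n b $$ (i, g k i))
          = (\<Prod>x\<in>?I. if g k (fst x) = snd x then b x else 1)" if "k \<in> {1..<n}" for k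
        using prod_cover[of "g k" n b] gk[OF that] gk_less[OF that] by simp
      then show ?thesis by (subst prod.swap) simp
    qed
    ultimately show ?thesis by (simp add: prod.distrib)
  qed
  then have "(\<Sum>B\<in>zero_one_mats n. (- 1) ^ num_zeros B * (\<Prod>i = 0..<n. B $$ (i, i))
      * (\<Prod>k\<in>{1..<n}. \<Prod>i = 0..<n. B $$ (i, g k i)))
    = (\<Sum>b\<in>?I \<rightarrow>\<^sub>E {0, 1}. \<Prod>x\<in>?I. ?c x (b x))"
    by (simp add: sum_zero_one_mats)
  also have "\<dots> = (\<Prod>x\<in>?I. \<Sum>b\<in>{0, 1}. ?c x b)"
    by (rule prod_sum_PiE[symmetric]) auto
  \<comment> \<open>Entry 1 contributes 1. Entry 0 contributes -1 if neither the diagonal nor any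
    \<open>g k\<close> meets the cell, and 0 otherwise.\<close>
  also have "\<dots> = (\<Prod>x\<in>?I. if fst x = snd x \<or> (\<exists>k\<in>{1..<n}. g k (fst x) = snd x) then 1 else 0)"
  proof (intro prod.cong refl)
    fix x assume "x \<in> ?I"
    have zero: "(\<Prod>k\<in>{1..<n}. if g k (fst x) = snd x then 0 else 1 :: int)
        = (if \<exists>k\<in>{1..<n}. g k (fst x) = snd x then 0 else 1)"
      by (auto intro: prod.neutral simp: prod_zero_iff)
    show "(\<Sum>b\<in>{0, 1}. ?c x b)
        = (if fst x = snd x \<or> (\<exists>k\<in>{1..<n}. g k (fst x) = snd x) then 1 else 0)"
      using zero by simp
  qed
  also have "\<dots> = (if \<forall>x\<in>?I. fst x = snd x \<or> (\<exists>k\<in>{1..<n}. g k (fst x) = snd x) then 1 else 0)"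
    by (auto intro!: prod.neutral)
  also have "(\<forall>x\<in>?I. fst x = snd x \<or> (\<exists>k\<in>{1..<n}. g k (fst x) = snd x)) \<longleftrightarrow> g \<in> normalized_latin n"
    using g by (simp add: normalized_latin_def Ball_def) blast
  finally show ?thesis .
qed

text \<open>The Leibniz formula in each of the \<open>n - 1\<close> factors, indexed by
  \<open>{1..<n}\<close>, produces tuples of permutations, while the diagonal product supplies the
  identity. After exchanging the sums, the inner sum is the indicator of
  \<open>normalized_latin n\<close>.\<close>

lemma sum_diag_det_power:
  "(\<Sum>B\<in>zero_one_mats n. (- 1) ^ num_zeros B * (\<Prod>i = 0..<n. B $$ (i, i)) * det B ^ (n - 1))
    = (\<Sum>g\<in>normalized_latin n. \<Prod>k\<in>{1..<n}. sign (g k))"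
proof -
  let ?G = "{1..<n} \<rightarrow>\<^sub>E {\<pi>. \<pi> permutes {0..<n}}"
  let ?w = "\<lambda>B :: int mat. (- 1) ^ num_zeros B * (\<Prod>i = 0..<n. B $$ (i, i))"
  let ?m = "\<lambda>g (B :: int mat). \<Prod>k\<in>{1..<n}. \<Prod>i = 0..<n. B $$ (i, g k i)"
  let ?s = "\<lambda>g :: nat \<Rightarrow> nat \<Rightarrow> nat. \<Prod>k\<in>{1..<n}. sign (g k)"
  have finG: "finite ?G" by (intro finite_PiE) (auto intro: finite_permutations)
  have "det B ^ (n - 1) = (\<Sum>g\<in>?G. ?s g * ?m g B)" if "B \<in> zero_one_mats n" for B
  proof -
    have "B \<in> carrier_mat n n" using that by (simp add: zero_one_mats_def)
    then have "det B ^ (n - 1)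
        = (\<Prod>k\<in>{1..<n}. \<Sum>\<pi> | \<pi> permutes {0..<n}. sign \<pi> * (\<Prod>i = 0..<n. B $$ (i, \<pi> i)))"
      by (simp add: det_def')
    also have "\<dots> = (\<Sum>g\<in>?G. \<Prod>k\<in>{1..<n}. sign (g k) * (\<Prod>i = 0..<n. B $$ (i, g k i)))"
      by (rule prod_sum_PiE) (auto intro: finite_permutations)
    finally show ?thesis by (simp add: prod.distrib)
  qed
  then have "(\<Sum>B\<in>zero_one_mats n. ?w B * det B ^ (n - 1))
      = (\<Sum>B\<in>zero_one_mats n. \<Sum>g\<in>?G. ?s g * (?w B * ?m g B))"
    by (intro sum.cong refl) (simp add: sum_distrib_left mult.left_commute)
  also have "\<dots> = (\<Sum>g\<in>?G. ?s g * (\<Sum>B\<in>zero_one_mats n. ?w B * ?m g B))"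
    by (subst sum.swap) (simp add: sum_distrib_left)
  also have "\<dots> = (\<Sum>g\<in>?G. ?s g * (if g \<in> normalized_latin n then 1 else 0))"
    by (intro sum.cong refl) (simp only: sum_monomial_zero_one_mats)
  also have "\<dots> = sum ?s (normalized_latin n)"
    by (rule sum.mono_neutral_cong_right[OF finG]) (auto simp: normalized_latin_def)
  finally show ?thesis .
qed

section \<open>Row permutation classes\<close>

definition permute_rows :: "nat \<Rightarrow> (nat \<Rightarrow> nat) \<Rightarrow> 'a mat \<Rightarrow> 'a mat" where
  "permute_rows n \<pi> A = mat n n (\<lambda>(i, j). A $$ (\<pi> i, j))"

lemma permute_rows_carrier [simp]: "permute_rows n \<pi> A \<in> carrier_mat n n"
  by (simp add: permute_rows_def)

lemma permute_rows_index [simp]: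
  "i < n \<Longrightarrow> j < n \<Longrightarrow> permute_rows n \<pi> A $$ (i, j) = A $$ (\<pi> i, j)"
  by (simp add: permute_rows_def)

lemma permute_rows_id: "A \<in> carrier_mat n n \<Longrightarrow> permute_rows n id A = A"
  by (intro eq_matI) (auto simp: permute_rows_def)

text \<open>Rows are looked up through the permutation, so the order of composition is
  reversed.\<close>

lemma permute_rows_comp:
  assumes "\<sigma> permutes {0..<n}"
  shows "permute_rows n \<sigma> (permute_rows n \<pi> A) = permute_rows n (\<pi> \<circ> \<sigma>) A"
proof -
  have "\<sigma> i < n" if "i < n" for i
    using permutes_in_image[OF assms, of i] that by simp
  then show ?thesis by (intro eq_matI) (auto simp: permute_rows_def)
qed

lemma row_perm_equiv_iff_permute_rows:
  assumes "A \<in> carrier_mat n n"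
  shows "row_perm_equiv A B \<longleftrightarrow> (\<exists>\<pi>. \<pi> permutes {0..<n} \<and> B = permute_rows n \<pi> A)"
  using assms by (auto simp: row_perm_equiv_def permute_rows_def)

lemma permute_rows_nonsing:
  assumes A: "A \<in> zero_one_mats_nonsing n" and \<pi>: "\<pi> permutes {0..<n}"
  shows "permute_rows n \<pi> A \<in> zero_one_mats_nonsing n"
proof -
  have "\<pi> i < n" if "i < n" for i
    using permutes_in_image[OF \<pi>, of i] that by simp
  moreover have "A \<in> carrier_mat n n"
    using A by (simp add: zero_one_mats_nonsing_def zero_one_mats_def)
  then have "det (permute_rows n \<pi> A) = sign \<pi> * det A"
    using det_permute_rows[OF _ \<pi>, of A] by (simp add: permute_rows_def)
  ultimately show ?thesis
    using A by (auto simp: zero_one_mats_nonsing_def zero_one_mats_def sign_def cong_0_iff)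
qed

lemma num_zeros_permute_rows:
  fixes A :: "int mat"
  assumes "A \<in> carrier_mat n n" and \<pi>: "\<pi> permutes {0..<n}"
  shows "(- 1 :: int) ^ num_zeros (permute_rows n \<pi> A) = (- 1) ^ num_zeros A"
proof -
  let ?f = "\<lambda>i. \<Prod>j\<in>{0..<n}. if A $$ (i, j) = 0 then - 1 else 1 :: int"
  have "(- 1 :: int) ^ num_zeros (permute_rows n \<pi> A) = (\<Prod>i\<in>{0..<n}. ?f (\<pi> i))"
    by (simp add: power_num_zeros[of _ n])
  also have "\<dots> = prod ?f {0..<n}"
    using prod.permute[OF \<pi>, of ?f] by (simp add: comp_def)
  also have "\<dots> = (- 1) ^ num_zeros A"
    using power_num_zeros[OF assms(1)] by simp
  finally show ?thesis .
qed

text \<open>Replacing each permutation by its inverse and reindexing the product moves the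
  permutation from the columns to the rows.\<close>

lemma per_eq_sum_diag_permute_rows:
  fixes A :: "'a :: comm_semiring_1 mat"
  assumes "A \<in> carrier_mat n n"
  shows "per A = (\<Sum>\<pi> | \<pi> permutes {0..<n}. \<Prod>i = 0..<n. permute_rows n \<pi> A $$ (i, i))"
proof -
  let ?P = "{\<pi>. \<pi> permutes {0..<n}}"
  have "per A = (\<Sum>\<pi>\<in>?P. \<Prod>i = 0..<n. A $$ (i, \<pi> i))"
    using assms by (auto simp: per_def)
  also have "\<dots> = (\<Sum>\<pi>\<in>?P. \<Prod>i = 0..<n. A $$ (i, Hilbert_Choice.inv \<pi> i))"
    by (rule sum_permutations_inverse)
  also have "\<dots> = (\<Sum>\<pi>\<in>?P. \<Prod>i = 0..<n. A $$ (\<pi> i, i))"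
  proof (intro sum.cong refl)
    fix \<pi> assume "\<pi> \<in> ?P"
    then have \<pi>: "\<pi> permutes {0..<n}" by simp
    show "(\<Prod>i = 0..<n. A $$ (i, Hilbert_Choice.inv \<pi> i)) = (\<Prod>i = 0..<n. A $$ (\<pi> i, i))"
      using prod.permute[OF \<pi>, of "\<lambda>i. A $$ (i, Hilbert_Choice.inv \<pi> i)"]
      by (simp add: comp_def permutes_inverses(2)[OF \<pi>])
  qed
  finally show ?thesis by simp
qed

text \<open>Existence and uniqueness of representatives determine \<open>A\<close>; a nonzero
  determinant makes the rows of \<open>A\<close> distinct, which determines
  \<open>\<pi>\<close>.\<close>

lemma bij_betw_permute_rows:
  assumes R: "row_perm_reps n R"
  shows "bij_betw (\<lambda>(A, \<pi>). permute_rows n \<pi> A)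
    ((R \<inter> zero_one_mats_nonsing n) \<times> {\<pi>. \<pi> permutes {0..<n}}) (zero_one_mats_nonsing n)"
    (is "bij_betw ?f (?RN \<times> ?P) ?N")
proof -
  have carrier: "A \<in> carrier_mat n n" and zo: "A \<in> zero_one_mats n" and nz: "det A \<noteq> 0"
    if "A \<in> ?N" for A
    using that by (auto simp: zero_one_mats_nonsing_def zero_one_mats_def)
  have "inj_on ?f (?RN \<times> ?P)"
  proof (rule inj_onI, clarify)
    fix A \<pi> B \<sigma>
    assume A: "A \<in> R" "A \<in> ?N" and B: "B \<in> R" "B \<in> ?N"
      and \<pi>: "\<pi> permutes {0..<n}" and \<sigma>: "\<sigma> permutes {0..<n}"
      and eq: "permute_rows n \<pi> A = permute_rows n \<sigma> B"
    have inv\<sigma>: "Hilbert_Choice.inv \<sigma> permutes {0..<n}" using \<sigma> by (rule permutes_inv)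
    have "B = permute_rows n (Hilbert_Choice.inv \<sigma>) (permute_rows n \<sigma> B)"
      using carrier[OF B(2)]
      by (simp add: permute_rows_comp[OF inv\<sigma>] permutes_inv_o[OF \<sigma>] permute_rows_id)
    then have "B = permute_rows n (\<pi> \<circ> Hilbert_Choice.inv \<sigma>) A"
      using eq permute_rows_comp[OF inv\<sigma>] by metis
    then have "row_perm_equiv A B"
      using row_perm_equiv_iff_permute_rows[OF carrier[OF A(2)]] permutes_compose[OF inv\<sigma> \<pi>] by blast
    \<comment> \<open>By reflexivity both \<open>A\<close> and \<open>B\<close> represent the class
      of \<open>A\<close>, so uniqueness identifies them.\<close>
    moreover have "row_perm_equiv A A"
      using row_perm_equiv_iff_permute_rows[OF carrier[OF A(2)]] permutes_id
        permute_rows_id[OF carrier[OF A(2)]] by metis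
    ultimately have AB: "A = B"
      using R zo[OF A(2)] A(1) B(1) unfolding row_perm_reps_def by blast
    \<comment> \<open>If the two values differed, \<open>A\<close> would have equal rows at two
      different positions and hence determinant 0.\<close>
    have "\<pi> i = \<sigma> i" for i
    proof (cases "i < n")
      case True
      have less: "\<pi> i < n" "\<sigma> i < n"
        using permutes_in_image[OF \<pi>, of i] permutes_in_image[OF \<sigma>, of i] True by auto
      have "row A (\<pi> i) = row A (\<sigma> i)"
      proof (rule eq_vecI)
        fix j assume "j < dim_vec (row A (\<sigma> i))"
        then have j: "j < n" using carrier[OF A(2)] by simp
        have "A $$ (\<pi> i, j) = A $$ (\<sigma> i, j)"
          using arg_cong[OF eq, of "\<lambda>M. M $$ (i, j)"] True j AB by simp
        then show "row A (\<pi> i) $ j = row A (\<sigma> i) $ j"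
          using carrier[OF A(2)] less j by simp
      qed simp
      then show ?thesis
        using det_identical_rows[OF carrier[OF A(2)] _ less] nz[OF A(2)] by blast
    next
      case False
      then show ?thesis using \<pi> \<sigma> by (simp add: permutes_not_in)
    qed
    then show "A = B \<and> \<pi> = \<sigma>" using AB by auto
  qed
  moreover have "?f ` (?RN \<times> ?P) = ?N"
  proof (intro equalityI subsetI)
    fix B assume "B \<in> ?f ` (?RN \<times> ?P)"
    then show "B \<in> ?N" using permute_rows_nonsing by auto
  next
    fix B assume B: "B \<in> ?N"
    then obtain A where A: "A \<in> R" "row_perm_equiv B A"
      using R zo unfolding row_perm_reps_def by blast
    then obtain \<pi> where \<pi>: "\<pi> permutes {0..<n}" "A = permute_rows n \<pi> B"
      using row_perm_equiv_iff_permute_rows[OF carrier[OF B]] by blast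
    have inv\<pi>: "Hilbert_Choice.inv \<pi> permutes {0..<n}" using \<pi>(1) by (rule permutes_inv)
    have "B = permute_rows n (Hilbert_Choice.inv \<pi>) A"
      using carrier[OF B]
      by (simp add: \<pi>(2) permute_rows_comp[OF inv\<pi>] permutes_inv_o[OF \<pi>(1)] permute_rows_id)
    moreover have "A \<in> ?N" using permute_rows_nonsing[OF B \<pi>(1)] \<pi>(2) by simp
    ultimately show "B \<in> ?f ` (?RN \<times> ?P)"
      using A(1) inv\<pi> by (intro image_eqI[of _ _ "(A, Hilbert_Choice.inv \<pi>)"]) auto
  qed
  ultimately show ?thesis by (simp add: bij_betw_def)
qed

text \<open>The sign is constant on a row permutation class, so it can be moved inside the expanded
  permanent; the bijection then merges the double sum.\<close>

lemma sum_reps_per_eq_sum_diag: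
  assumes R: "row_perm_reps n R"
  shows "(\<Sum>A\<in>R \<inter> zero_one_mats_nonsing n. (- 1) ^ num_zeros A * per A)
    = (\<Sum>B\<in>zero_one_mats_nonsing n. (- 1) ^ num_zeros B * (\<Prod>i = 0..<n. B $$ (i, i)))"
proof -
  let ?w = "\<lambda>B :: int mat. (- 1) ^ num_zeros B * (\<Prod>i = 0..<n. B $$ (i, i))"
  have "(\<Sum>A\<in>R \<inter> zero_one_mats_nonsing n. (- 1) ^ num_zeros A * per A)
    = (\<Sum>A\<in>R \<inter> zero_one_mats_nonsing n. \<Sum>\<pi> | \<pi> permutes {0..<n}. ?w (permute_rows n \<pi> A))"
  proof (intro sum.cong refl)
    fix A assume "A \<in> R \<inter> zero_one_mats_nonsing n"
    then have A: "A \<in> carrier_mat n n"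
      by (auto simp: zero_one_mats_nonsing_def zero_one_mats_def)
    show "(- 1) ^ num_zeros A * per A
        = (\<Sum>\<pi> | \<pi> permutes {0..<n}. ?w (permute_rows n \<pi> A))"
      unfolding per_eq_sum_diag_permute_rows[OF A] sum_distrib_left
      by (intro sum.cong refl) (simp only: mem_Collect_eq num_zeros_permute_rows[OF A])
  qed
  also have "\<dots> = (\<Sum>x\<in>(R \<inter> zero_one_mats_nonsing n) \<times> {\<pi>. \<pi> permutes {0..<n}}.
      ?w ((\<lambda>(A, \<pi>). permute_rows n \<pi> A) x))"
    by (simp only: sum.cartesian_product case_prod_unfold)
  also have "\<dots> = sum ?w (zero_one_mats_nonsing n)"
    by (rule sum.reindex_bij_betw[OF bij_betw_permute_rows[OF R]])
  finally show ?thesis .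
qed

section \<open>Fermat's little theorem for integers and the final congruence\<close>

lemma fermat_theorem_int:
  fixes a :: int and p :: nat
  assumes "prime p" and "\<not> [a = 0] (mod int p)"
  shows "[a ^ (p - 1) = 1] (mod int p)"
proof -
  have p0: "0 < p" using assms prime_gt_0_nat by blast
  \<comment> \<open>The natural residue of \<open>a\<close>, possibly negative itself, gives access
    to Fermat's theorem for natural numbers.\<close>
  define b where "b = nat (a mod int p)"
  have b: "int b = a mod int p" using p0 by (simp add: b_def)
  then have "[a = int b] (mod int p)" by (simp add: cong_def)
  then have "[a ^ (p - 1) = int b ^ (p - 1)] (mod int p)" by (rule cong_pow)
  moreover have "\<not> p dvd b"
    using assms(2) b p0 by (metis cong_0_iff dvd_mod_iff dvd_refl int_dvd_int_iff)
  then have "[int b ^ (p - 1) = 1] (mod int p)"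
    using fermat_theorem[OF assms(1), of b] by (metis cong_int_iff of_nat_1 of_nat_power)
  ultimately show ?thesis by (rule cong_trans)
qed

theorem theorem8:
  fixes p :: nat and R :: "int mat set"
  assumes "prime p" and "odd p"
    and "row_perm_reps p R"
  shows "[(\<Sum>A \<in> R \<inter> zero_one_mats_nonsing p. (-1) ^ num_zeros A * per A) = -1] (mod int p)"
proof -
  let ?w = "\<lambda>B :: int mat. (- 1) ^ num_zeros B * (\<Prod>i = 0..<p. B $$ (i, i))"
  have p1: "1 < p" using assms(1) prime_gt_1_nat by blast
  have "(\<Sum>A \<in> R \<inter> zero_one_mats_nonsing p. (-1) ^ num_zeros A * per A)
      = (\<Sum>B\<in>zero_one_mats p. if \<not> [det B = 0] (mod int p) then ?w B else 0)"
    unfolding sum_reps_per_eq_sum_diag[OF assms(3)] unfolding zero_one_mats_nonsing_def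
    by (rule sum.inter_filter[OF finite_zero_one_mats])
  \<comment> \<open>Modulo \<open>p\<close>, the power \<open>det B ^ (p - 1)\<close> is the
    indicator of nonsingularity; in the singular case this relies on \<open>p - 1\<close> being
    positive.\<close>
  also have "[\<dots> = (\<Sum>B\<in>zero_one_mats p. ?w B * det B ^ (p - 1))] (mod int p)"
  proof (rule cong_sum)
    fix B assume "B \<in> zero_one_mats p"
    show "[(if \<not> [det B = 0] (mod int p) then ?w B else 0) = ?w B * det B ^ (p - 1)] (mod int p)"
    proof (cases "[det B = 0] (mod int p)")
      case True
      then have "[det B ^ (p - 1) = 0 ^ (p - 1)] (mod int p)" by (rule cong_pow)
      then have "[?w B * det B ^ (p - 1) = ?w B * 0] (mod int p)"
        using p1 by (intro cong_scalar_left) (simp add: power_0_left)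
      then show ?thesis using True by (simp add: cong_sym)
    next
      case False
      then have "[?w B * det B ^ (p - 1) = ?w B * 1] (mod int p)"
        by (intro cong_scalar_left fermat_theorem_int[OF assms(1)])
      then show ?thesis using False by (simp add: cong_sym)
    qed
  qed
  also have "(\<Sum>B\<in>zero_one_mats p. ?w B * det B ^ (p - 1))
      = (\<Sum>g\<in>normalized_latin p. \<Prod>k\<in>{1..<p}. sign (g k))"
    by (rule sum_diag_det_power)
  also have "[\<dots> = - 1] (mod int p)"
    by (rule sum_sign_normalized_latin[OF assms(1,2)])
  finally show ?thesis .
qed

end
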